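(* Let $f\in\mathcal{U}$. Then the following are equivalent: (i) for every fixed $\zeta\in\mathbb{D}$, the Koebe transform $z\mapsto g(\zeta,z)$ of $f$ with respect to $\zeta$ belongs to $\mathcal{U}$; (ii) $$\left|\frac{(\zeta-u)^2 f'(\zeta)f'(u)}{(f(u)-f(\zeta))^2}-1\right|<1\quad\text{for all } \zeta,u\in\mathbb{D}.$$
   Context: $\mathbb{D}=\{z\in\mathbb{C}: |z|<1\}$. $\mathcal{A}$ is the family of functions $f$ analytic in $\mathbb{D}$ with $f(0)=0$ and $f'(0)=1$. $\mathcal{S}$ is the subclass of $\mathcal{A}$ consisting of univalent (injective) functions in $\mathbb{D}$. $\mathcal{U}$ is the subclass of those $f\in\mathcal{S}$ such that $$\left|\left(\frac{z}{f(z)}\right)^2 f'(z)-1\right|<1\quad\text{for all } z\in\mathbb{D},$$ where $z/f(z)$ is given its limit value $1$ at $z=0$. For $f\in\mathcal{S}$ and $\zeta\in\mathbb{D}$, the Koebe transform of $f$ with respect to $\zeta$ is the function of $z\in\mathbb{D}$ $$g(\zeta,z)=\frac{f\left(\frac{\zeta+z}{1+\overline{\zeta}z}\right)-f(\zeta)}{f'(\zeta)(1-|\zeta|^2)}.$$ When $u=\zeta$, the quotient $\frac{(\zeta-u)^2 f'(\zeta)f'(u)}{(f(u)-f(\zeta))^2}$ is understood as its limit value $1$. *)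

theory Defs
  imports "HOL-Analysis.Analysis"
begin

text \<open>
  Functions on the unit disc are total functions on the complex numbers of which only the
  values on the disc matter.
\<close>

abbreviation unit_disc :: "complex set" where
  "unit_disc \<equiv> ball 0 1"

definition class_A :: "(complex \<Rightarrow> complex) set" where
  "class_A = {f. f analytic_on unit_disc \<and> f 0 = 0 \<and> deriv f 0 = 1}"

definition class_S :: "(complex \<Rightarrow> complex) set" where
  "class_S = {f \<in> class_A. inj_on f unit_disc}"

text \<open>
  The value \<open>1\<close> at \<open>z = 0\<close> is the limit there for a function in \<open>class_A\<close>; division in HOL
  would give \<open>0 / 0 = 0\<close>.
\<close>

definition z_over :: "(complex \<Rightarrow> complex) \<Rightarrow> complex \<Rightarrow> complex" where
  "z_over f z = (if z = 0 then 1 else z / f z)"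

definition class_U :: "(complex \<Rightarrow> complex) set" where
  "class_U = {f \<in> class_S. \<forall>z\<in>unit_disc. cmod ((z_over f z)\<^sup>2 * deriv f z - 1) < 1}"

definition koebe_transform :: "(complex \<Rightarrow> complex) \<Rightarrow> complex \<Rightarrow> complex \<Rightarrow> complex" where
  "koebe_transform f \<zeta> z =
     (f ((\<zeta> + z) / (1 + cnj \<zeta> * z)) - f \<zeta>) / (deriv f \<zeta> * (1 - (of_real (cmod \<zeta>))\<^sup>2))"

text \<open>
  On the diagonal this is again the limit value, for \<open>f\<close> univalent on the disc.
\<close>

definition two_point_quotient :: "(complex \<Rightarrow> complex) \<Rightarrow> complex \<Rightarrow> complex \<Rightarrow> complex" where
  "two_point_quotient f \<zeta> u =
     (if u = \<zeta> then 1 else (\<zeta> - u)\<^sup>2 * deriv f \<zeta> * deriv f u / (f u - f \<zeta>)\<^sup>2)"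

end

theory Submission
  imports Defs "HOL-Complex_Analysis.Riemann_Mapping"
begin

text \<open>
  Put \<open>u = (\<zeta> + z) / (1 + cnj \<zeta> * z)\<close> and let \<open>g\<close> be the Koebe transform of \<open>f\<close> at \<open>\<zeta>\<close>.
  Since \<open>u - \<zeta> = z * (1 - (cmod \<zeta>)\<^sup>2) / (1 + cnj \<zeta> * z)\<close> and
  \<open>g' z = f' u / (f' \<zeta> * (1 + cnj \<zeta> * z)\<^sup>2)\<close>, the expression \<open>(z / g z)\<^sup>2 * g' z\<close> equals
  the two-point quotient of \<open>f\<close> at \<open>\<zeta>\<close> and \<open>u\<close>. As \<open>z\<close> runs through the disc, so does \<open>u\<close>.
\<close>

lemma one_plus_cnj_mult_neq_0:
  assumes "cmod \<zeta> < 1" "cmod z < 1"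
  shows "1 + cnj \<zeta> * z \<noteq> 0"
proof
  assume "1 + cnj \<zeta> * z = 0"
  then have "cnj \<zeta> * z = - 1"
    by (simp add: add_eq_0_iff)
  then have "cmod \<zeta> * cmod z = 1"
    by (metis complex_mod_cnj norm_minus_cancel norm_mult norm_one)
  moreover have "cmod (\<zeta> * z) < 1"
    using norm_mult_less[OF assms] by simp
  ultimately show False
    by (simp add: norm_mult)
qed

lemma one_minus_norm_square_neq_0:
  assumes "cmod \<zeta> < 1"
  shows "1 - (of_real (cmod \<zeta>))\<^sup>2 \<noteq> (0::complex)"
proof -
  have "(cmod \<zeta>)\<^sup>2 \<noteq> 1"
    using assms by (simp add: abs_square_eq_1)
  then show ?thesis
    by (metis eq_iff_diff_eq_0 of_real_eq_1_iff of_real_power)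
qed

text \<open>\<open>Moebius_function 0 w z\<close> is \<open>(z - w) / (1 - cnj w * z)\<close>, hence
  the parameter \<open>- \<zeta>\<close>. This form gives access to the known norm bound and
  composition law of disc automorphisms.\<close>

lemma koebe_transform_Moebius:
  "koebe_transform f \<zeta> z =
     (f (Moebius_function 0 (- \<zeta>) z) - f \<zeta>) / (deriv f \<zeta> * (1 - (of_real (cmod \<zeta>))\<^sup>2))"
  by (simp add: koebe_transform_def Moebius_function_simple add.commute)

lemma Moebius_function_diff:
  assumes "cmod \<zeta> < 1" "cmod z < 1"
  shows "Moebius_function 0 (- \<zeta>) z - \<zeta> =
           z * (1 - (of_real (cmod \<zeta>))\<^sup>2) / (1 + cnj \<zeta> * z)"
  \<comment> \<open>The numerator is \<open>z + \<zeta> - \<zeta> * (1 + cnj \<zeta> * z)\<close>,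
    and \<open>\<zeta> * cnj \<zeta>\<close> is the squared modulus of
    \<open>\<zeta>\<close>.\<close>
  using one_plus_cnj_mult_neq_0[OF assms] complex_norm_square[of \<zeta>]
  by (simp add: Moebius_function_simple field_simps)

lemma DERIV_Moebius_function:
  assumes "cmod \<zeta> < 1" "cmod z < 1"
  shows "(Moebius_function 0 (- \<zeta>) has_field_derivative
           (1 - (of_real (cmod \<zeta>))\<^sup>2) / (1 + cnj \<zeta> * z)\<^sup>2) (at z)"
proof -
  have "((\<lambda>z. (z + \<zeta>) / (1 + cnj \<zeta> * z)) has_field_derivative
           (1 - (of_real (cmod \<zeta>))\<^sup>2) / (1 + cnj \<zeta> * z)\<^sup>2) (at z)"
    using one_plus_cnj_mult_neq_0[OF assms] complex_norm_square[of \<zeta>]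
    by (auto intro!: derivative_eq_intros simp: power2_eq_square algebra_simps)
  then show ?thesis
    by (simp add: Moebius_function_def[abs_def])
qed

text \<open>The inverse automorphism has the opposite parameter: a preimage of \<open>u\<close> is
  \<open>Moebius_function 0 \<zeta> u\<close>, which again lies in the disc.\<close>

lemma Moebius_function_minus_image_disc:
  assumes "cmod \<zeta> < 1"
  shows "Moebius_function 0 (- \<zeta>) ` unit_disc = unit_disc"
proof
  show "Moebius_function 0 (- \<zeta>) ` unit_disc \<subseteq> unit_disc"
    using assms by (auto intro!: Moebius_function_norm_lt_1)
  show "unit_disc \<subseteq> Moebius_function 0 (- \<zeta>) ` unit_disc"
  proof
    fix u assume "u \<in> unit_disc"
    then show "u \<in> Moebius_function 0 (- \<zeta>) ` unit_disc"
      using assms Moebius_function_compose[of "- \<zeta>" \<zeta> u] Moebius_function_norm_lt_1[of \<zeta> u 0]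
      by (intro image_eqI[of _ _ "Moebius_function 0 \<zeta> u"]) auto
  qed
qed

lemma inj_on_Moebius_function_minus:
  assumes "cmod \<zeta> < 1"
  shows "inj_on (Moebius_function 0 (- \<zeta>)) unit_disc"
  using assms Moebius_function_compose[of \<zeta> "- \<zeta>"]
  by (intro inj_on_inverseI[of _ "Moebius_function 0 \<zeta>"]) auto

lemma class_S_holomorphic: "f \<in> class_S \<Longrightarrow> f holomorphic_on unit_disc"
  by (simp add: class_S_def class_A_def analytic_on_open)

text \<open>An injective holomorphic function has no critical points, so the denominator
  \<open>deriv f \<zeta>\<close> of the Koebe transform does not vanish.\<close>

lemma class_S_deriv_neq_0:
  assumes "f \<in> class_S" "cmod z < 1"
  shows "deriv f z \<noteq> 0"
  using assms holomorphic_injective_imp_regular[OF class_S_holomorphic[OF assms(1)]]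
  by (simp add: class_S_def)

lemma DERIV_koebe_transform:
  assumes "f \<in> class_S" "cmod \<zeta> < 1" "cmod z < 1"
  shows "(koebe_transform f \<zeta> has_field_derivative
           deriv f (Moebius_function 0 (- \<zeta>) z) / (deriv f \<zeta> * (1 + cnj \<zeta> * z)\<^sup>2)) (at z)"
proof -
  let ?M = "Moebius_function 0 (- \<zeta>)"
  have "(f has_field_derivative deriv f (?M z)) (at (?M z))"
    using assms Moebius_function_norm_lt_1[of "- \<zeta>" z 0]
    by (intro holomorphic_derivI[OF class_S_holomorphic]) auto
  from DERIV_chain2[OF this DERIV_Moebius_function[OF assms(2,3)]]
  have "((\<lambda>z. f (?M z)) has_field_derivative
          deriv f (?M z) * ((1 - (of_real (cmod \<zeta>))\<^sup>2) / (1 + cnj \<zeta> * z)\<^sup>2)) (at z)" .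
  \<comment> \<open>The term \<open>- 0\<close> is the derivative of the constant
    \<open>f \<zeta>\<close>. The factor \<open>1 - (of_real (cmod \<zeta>))\<^sup>2\<close> then
    cancels against the normalisation.\<close>
  then have "((\<lambda>z. (f (?M z) - f \<zeta>) / (deriv f \<zeta> * (1 - (of_real (cmod \<zeta>))\<^sup>2)))
      has_field_derivative
        (deriv f (?M z) * ((1 - (of_real (cmod \<zeta>))\<^sup>2) / (1 + cnj \<zeta> * z)\<^sup>2) - 0) /
        (deriv f \<zeta> * (1 - (of_real (cmod \<zeta>))\<^sup>2))) (at z)"
    by (intro DERIV_cdivide DERIV_diff DERIV_const)
  then show ?thesis
    using one_minus_norm_square_neq_0[OF assms(2)]
    by (simp add: koebe_transform_Moebius[abs_def] mult.commute)
qed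

lemma koebe_transform_class_S:
  assumes "f \<in> class_S" "cmod \<zeta> < 1"
  shows "koebe_transform f \<zeta> \<in> class_S"
proof -
  let ?M = "Moebius_function 0 (- \<zeta>)"
  have "koebe_transform f \<zeta> holomorphic_on unit_disc"
    using DERIV_koebe_transform[OF assms]
    by (metis holomorphic_on_open mem_ball_0 open_ball)
  moreover have "koebe_transform f \<zeta> 0 = 0"
    by (simp add: koebe_transform_def)
  moreover have "deriv (koebe_transform f \<zeta>) 0 = 1"
    using DERIV_imp_deriv[OF DERIV_koebe_transform[OF assms, of 0]] class_S_deriv_neq_0[OF assms]
    by (simp add: Moebius_function_of_zero)
  moreover have "inj_on (koebe_transform f \<zeta>) unit_disc"
  proof -
    \<comment> \<open>The Koebe transform is this composition followed by an affine map with nonzero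
      slope.\<close>
    have "inj_on (f \<circ> ?M) unit_disc"
      using assms
      by (intro comp_inj_on)
        (auto simp: class_S_def Moebius_function_minus_image_disc inj_on_Moebius_function_minus)
    then show ?thesis
      using class_S_deriv_neq_0[OF assms] one_minus_norm_square_neq_0[OF assms(2)]
      by (simp add: inj_on_def koebe_transform_Moebius)
  qed
  ultimately show ?thesis
    by (simp add: class_S_def class_A_def analytic_on_open)
qed

lemma two_point_quotient_Moebius:
  assumes "f \<in> class_S" "cmod \<zeta> < 1" "cmod z < 1"
  shows "(z_over (koebe_transform f \<zeta>) z)\<^sup>2 * deriv (koebe_transform f \<zeta>) z =
           two_point_quotient f \<zeta> (Moebius_function 0 (- \<zeta>) z)"
proof (cases "z = 0")
  \<comment> \<open>Here \<open>u = \<zeta>\<close>, so both limit conventions apply: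
    \<open>z_over\<close> and the quotient are set to 1, and the derivative of the Koebe transform
    at 0 is 1.\<close>
  case True
  then show ?thesis
    using koebe_transform_class_S[OF assms(1,2)]
    by (simp add: z_over_def two_point_quotient_def Moebius_function_of_zero class_S_def class_A_def)
next
  case False
  define u where "u = Moebius_function 0 (- \<zeta>) z"
  define c :: complex where "c = 1 - (of_real (cmod \<zeta>))\<^sup>2"
  define d where "d = 1 + cnj \<zeta> * z"
  have nz: "c \<noteq> 0" "d \<noteq> 0" "deriv f \<zeta> \<noteq> 0"
    using assms one_minus_norm_square_neq_0 one_plus_cnj_mult_neq_0 class_S_deriv_neq_0
    by (auto simp: c_def d_def)
  have diff: "u - \<zeta> = z * c / d"
    unfolding u_def c_def d_def using assms by (intro Moebius_function_diff)
  with False nz have "u \<noteq> \<zeta>"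
    by auto
  moreover have "cmod u < 1"
    using assms unfolding u_def by (intro Moebius_function_norm_lt_1) auto
  \<comment> \<open>Univalence keeps the double fraction below from degenerating into a division by
    zero.\<close>
  ultimately have "f u - f \<zeta> \<noteq> 0"
    using assms by (auto simp: class_S_def dest: inj_onD)
  have "(z_over (koebe_transform f \<zeta>) z)\<^sup>2 * deriv (koebe_transform f \<zeta>) z =
      (z / ((f u - f \<zeta>) / (deriv f \<zeta> * c)))\<^sup>2 * (deriv f u / (deriv f \<zeta> * d\<^sup>2))"
    using False DERIV_imp_deriv[OF DERIV_koebe_transform[OF assms]]
    by (simp add: z_over_def koebe_transform_Moebius u_def c_def d_def)
  \<comment> \<open>Squaring gives two factors \<open>deriv f \<zeta>\<close>, one of which cancels;
    the rest is grouped so that \<open>z * c / d\<close> can be read as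
    \<open>u - \<zeta>\<close>.\<close>
  also have "\<dots> = (z * c / d)\<^sup>2 * deriv f \<zeta> * deriv f u / (f u - f \<zeta>)\<^sup>2"
    using nz \<open>f u - f \<zeta> \<noteq> 0\<close> by (simp add: power2_eq_square mult_ac)
  also have "\<dots> = two_point_quotient f \<zeta> u"
    using \<open>u \<noteq> \<zeta>\<close> by (simp add: two_point_quotient_def diff[symmetric] power2_commute)
  finally show ?thesis
    unfolding u_def .
qed

lemma koebe_transform_class_U_iff:
  assumes "f \<in> class_S" "cmod \<zeta> < 1"
  shows "koebe_transform f \<zeta> \<in> class_U \<longleftrightarrow>
           (\<forall>u\<in>unit_disc. cmod (two_point_quotient f \<zeta> u - 1) < 1)"
proof -
  let ?M = "Moebius_function 0 (- \<zeta>)"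
  have "koebe_transform f \<zeta> \<in> class_U \<longleftrightarrow>
      (\<forall>z\<in>unit_disc. cmod (two_point_quotient f \<zeta> (?M z) - 1) < 1)"
    using assms by (simp add: class_U_def koebe_transform_class_S two_point_quotient_Moebius)
  \<comment> \<open>Moving the quantifier to the image lets surjectivity of the automorphism replace
    \<open>z\<close> by a free point \<open>u\<close> of the disc.\<close>
  also have "\<dots> \<longleftrightarrow> (\<forall>u\<in>?M ` unit_disc. cmod (two_point_quotient f \<zeta> u - 1) < 1)"
    by simp
  finally show ?thesis
    unfolding Moebius_function_minus_image_disc[OF assms(2)] .
qed

theorem theorem2:
  fixes f :: "complex \<Rightarrow> complex"
  assumes "f \<in> class_U"
  shows "(\<forall>\<zeta>\<in>unit_disc. koebe_transform f \<zeta> \<in> class_U) \<longleftrightarrow>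
         (\<forall>\<zeta>\<in>unit_disc. \<forall>u\<in>unit_disc. cmod (two_point_quotient f \<zeta> u - 1) < 1)"
proof -
  have "f \<in> class_S"
    using assms by (simp add: class_U_def)
  then show ?thesis
    by (simp add: koebe_transform_class_U_iff)
qed

end
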